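(* Let $G=\operatorname{GEV}(\mu,\gamma,\alpha,\ell)$ be a $d$-variate generalized extreme-value distribution with $\sigma=\alpha-\gamma\mu\in(0,\infty)^d$, and let $H=\operatorname{GP}(G)$ be the associated generalized Pareto distribution. Put $\tau_j=-\log G_j(0)=(1-\gamma_j\mu_j/\alpha_j)^{-1/\gamma_j}$ and $\pi_j=\tau_j/\ell(\tau)$ for $j=1,\dots,d$. Then each of $\gamma$, $\sigma$, $\pi$ and $\ell$ is identifiable from $H$ (i.e. uniquely determined by $H$), and $\ell(\pi)=1$. More precisely, writing $\overline H=1-H$ and $\overline H_j=1-H_j$, where $H_1,\dots,H_d$ are the marginal cdfs of $H$, we have, for all $x\in[0,\infty)^d$ and all $j=1,\dots,d$, $$\overline H_j(0)=\pi_j,$$ $$\frac{\overline H_j(x_j)}{\overline H_j(0)}=(1+\gamma_jx_j/\sigma_j)^{-1/\gamma_j}\quad\text{provided }\sigma_j+\gamma_jx_j>0,$$ $$\overline H(x)=\ell\{\overline H_1(x_1),\dots,\overline H_d(x_d)\}.$$ Furthermore, $\tau=\ell(\tau)\,\pi$, so that the vector $\tau$ is identifiable from $H$ up to a (positive) constant multiple.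
   Context: Conventions: $(1+\gamma x)^{-1/\gamma}$ is read as $e^{-x}$ if $\gamma=0$. Operations and order relations between vectors are componentwise; $a\wedge b=\min(a,b)$. A function $\ell:[0,\infty)^d\to[0,\infty)$ is a stable tail dependence function (stdf) if there is a random vector $V$ with values in $[0,\infty)^d$ and $\mathbb E[V_j]=1$ for all $j$ such that $\ell(y)=\mathbb E[\max_{j}(y_jV_j)]$ for all $y\in[0,\infty)^d$. For $\mu,\gamma\in\mathbb R^d$, $\alpha\in(0,\infty)^d$ and $\ell$ a stdf, $G=\operatorname{GEV}(\mu,\gamma,\alpha,\ell)$ denotes the cdf on $\mathbb R^d$ with margins $G_j(x_j)=\exp[-\{1+\gamma_j(x_j-\mu_j)/\alpha_j\}^{-1/\gamma_j}]$ for $x_j$ with $\alpha_j+\gamma_j(x_j-\mu_j)>0$ (read as $\exp[-\exp\{-(x_j-\mu_j)/\alpha_j\}]$ if $\gamma_j=0$; otherwise $G_j$ equals $0$ below its lower endpoint and $1$ above its upper endpoint), and with $G(x)=\exp[-\ell\{-\log G_1(x_1),\dots,-\log G_d(x_d)\}]$ whenever $G_j(x_j)>0$ for all $j$. Let $\eta_j\in[-\infty,0)$ be the lower endpoint of $G_j$ (the condition $0<G_j(0)<1$ is equivalent to $\sigma_j>0$). $H=\operatorname{GP}(G)$ is the probability distribution concentrated on $\{x\in[-\infty,\infty)^d: x\ge\eta,\ x_j>0\text{ for some }j\}$ whose cdf (also denoted $H$) is $$H(x)=\frac{\log G(x\wedge 0)-\log G(x)}{\log G(0)},\qquad x\in\mathbb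 R^d,\ x_j>\eta_j\ \text{for all } j.$$ *)

theory Defs
  imports "HOL-Probability.Probability"
begin

text \<open>
  A stdf lives on the nonnegative orthant; as a HOL function its values elsewhere are
  arbitrary and never used. The random vector \<open>V\<close> enters only through its law
  \<open>M\<close>, a Borel probability measure on the vectors.
\<close>

definition is_stdf :: "(real ^ 'n::finite \<Rightarrow> real) \<Rightarrow> bool" where
  "is_stdf l \<longleftrightarrow> (\<exists>M :: (real ^ 'n) measure.
     prob_space M \<and> sets M = sets borel \<and>
     (AE v in M. \<forall>j. 0 \<le> v $ j) \<and>
     (\<forall>j. integrable M (\<lambda>v. v $ j) \<and> (\<integral>v. v $ j \<partial>M) = 1) \<and>
     (\<forall>y. (\<forall>j. 0 \<le> y $ j) \<longrightarrow> l y = (\<integral>v. (MAX j. y $ j * v $ j) \<partial>M)))"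

text \<open>\<open>gpow g x\<close> is \<open>(1 + g x)\<close> to the power \<open>-1/g\<close>, for \<open>1 + g x > 0\<close>.\<close>

definition gpow :: "real \<Rightarrow> real \<Rightarrow> real" where
  "gpow g x = (if g = 0 then exp (- x) else (1 + g * x) powr (- 1 / g))"

definition gev_margin ::
    "real ^ 'n::finite \<Rightarrow> real ^ 'n \<Rightarrow> real ^ 'n \<Rightarrow> 'n \<Rightarrow> real \<Rightarrow> real" where
  "gev_margin \<mu> \<gamma> \<alpha> j t =
     (if \<alpha> $ j + \<gamma> $ j * (t - \<mu> $ j) > 0 then exp (- gpow (\<gamma> $ j) ((t - \<mu> $ j) / \<alpha> $ j))
      else if \<gamma> $ j > 0 then 0 else 1)"

text \<open>The value \<open>0\<close> in the second case is forced, a joint cdf being bounded by its margins.\<close>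

definition gev_cdf ::
    "real ^ 'n::finite \<Rightarrow> real ^ 'n \<Rightarrow> real ^ 'n \<Rightarrow> (real ^ 'n \<Rightarrow> real) \<Rightarrow> real ^ 'n \<Rightarrow> real" where
  "gev_cdf \<mu> \<gamma> \<alpha> l x =
     (if \<forall>j. gev_margin \<mu> \<gamma> \<alpha> j (x $ j) > 0
      then exp (- l (\<chi> j. - ln (gev_margin \<mu> \<gamma> \<alpha> j (x $ j)))) else 0)"

definition lower_endpoint :: "(real \<Rightarrow> real) \<Rightarrow> ereal" where
  "lower_endpoint F = (INF t \<in> {t. F t > 0}. ereal t)"

definition joint_cdf :: "(ereal ^ 'n::finite) measure \<Rightarrow> real ^ 'n \<Rightarrow> real" where
  "joint_cdf H x = measure H {y. \<forall>j. y $ j \<le> ereal (x $ j)}"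

definition marginal_cdf :: "(ereal ^ 'n::finite) measure \<Rightarrow> 'n \<Rightarrow> real \<Rightarrow> real" where
  "marginal_cdf H j t = measure H {y. y $ j \<le> ereal t}"

text \<open>
  \<open>is_GP F G H\<close> says that \<open>H\<close> is the generalized Pareto distribution GP(\<open>G\<close>), where
  \<open>G\<close> is a joint cdf with margins \<open>F j\<close>. Coordinates may take the value \<open>-\<infinity>\<close> with positive
  probability, so \<open>H\<close> is a measure on vectors of extended reals.
\<close>

definition is_GP ::
    "('n::finite \<Rightarrow> real \<Rightarrow> real) \<Rightarrow> (real ^ 'n \<Rightarrow> real) \<Rightarrow> (ereal ^ 'n) measure \<Rightarrow> bool" where
  "is_GP F G H \<longleftrightarrow>
     prob_space H \<and> sets H = sets borel \<and>
     (AE y in H. (\<forall>j. lower_endpoint (F j) \<le> y $ j \<and> y $ j < \<infinity>) \<and> (\<exists>j. 0 < y $ j)) \<and>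
     (\<forall>x. (\<forall>j. lower_endpoint (F j) < ereal (x $ j)) \<longrightarrow>
        joint_cdf H x = (ln (G (\<chi> j. min (x $ j) 0)) - ln (G x)) / ln (G 0))"

definition gp_sigma :: "real ^ 'n::finite \<Rightarrow> real ^ 'n \<Rightarrow> real ^ 'n \<Rightarrow> real ^ 'n" where
  "gp_sigma \<mu> \<gamma> \<alpha> = (\<chi> j. \<alpha> $ j - \<gamma> $ j * \<mu> $ j)"

definition gp_tau :: "real ^ 'n::finite \<Rightarrow> real ^ 'n \<Rightarrow> real ^ 'n \<Rightarrow> real ^ 'n" where
  "gp_tau \<mu> \<gamma> \<alpha> = (\<chi> j. - ln (gev_margin \<mu> \<gamma> \<alpha> j 0))"

definition gp_pi ::
    "real ^ 'n::finite \<Rightarrow> real ^ 'n \<Rightarrow> real ^ 'n \<Rightarrow> (real ^ 'n \<Rightarrow> real) \<Rightarrow> real ^ 'n" where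
  "gp_pi \<mu> \<gamma> \<alpha> l = (\<chi> j. gp_tau \<mu> \<gamma> \<alpha> $ j / l (gp_tau \<mu> \<gamma> \<alpha>))"

text \<open>
  \<open>gp_model \<mu> \<gamma> \<alpha> l H\<close>: the parameters are admissible, \<open>\<sigma>\<close> is positive, and
  \<open>H\<close> = GP(GEV(\<open>\<mu>\<close>, \<open>\<gamma>\<close>, \<open>\<alpha>\<close>, \<open>l\<close>)).
\<close>

definition gp_model ::
    "real ^ 'n::finite \<Rightarrow> real ^ 'n \<Rightarrow> real ^ 'n \<Rightarrow> (real ^ 'n \<Rightarrow> real) \<Rightarrow> (ereal ^ 'n) measure \<Rightarrow> bool"
  where
  "gp_model \<mu> \<gamma> \<alpha> l H \<longleftrightarrow>
     (\<forall>j. 0 < \<alpha> $ j) \<and> is_stdf l \<and> (\<forall>j. 0 < gp_sigma \<mu> \<gamma> \<alpha> $ j) \<and>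
     is_GP (gev_margin \<mu> \<gamma> \<alpha>) (gev_cdf \<mu> \<gamma> \<alpha> l) H"

end

theory Submission
  imports Defs "HOL-Real_Asymp.Real_Asymp"
begin

text \<open>
  For \<open>x \<ge> 0\<close> the numerator of the GP cdf only involves \<open>G 0\<close> and \<open>G x\<close>. Since \<open>- log G\<^sub>j\<close>
  factors as \<open>\<tau>\<^sub>j\<close> times the univariate GP survival function \<open>S\<^sub>j\<close>, homogeneity of the stdf turns
  the joint survival function into \<open>l (\<pi>\<^sub>j S\<^sub>j(x\<^sub>j))\<^sub>j\<close>. Letting all coordinates but one tend to
  infinity gives the margins \<open>\<pi>\<^sub>j S\<^sub>j\<close>, because the stdf lies between the maximum and the sum of
  its arguments. The margins determine \<open>\<pi>\<close>, \<open>\<gamma>\<close> and \<open>\<sigma>\<close>; as \<open>x\<close> varies, their values sweep out a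
  box \<open>\<Prod>\<^sub>j (0, \<pi>\<^sub>j]\<close>, on which the joint survival function determines the stdf, hence
  everywhere by homogeneity and continuity.
\<close>

section \<open>Stable tail dependence functions\<close>

text \<open>The maximum over a finite index set is attained, so its absolute value is at most the
  sum of all absolute values, which is an integrable majorant.\<close>

lemma integrable_Max_range:
  fixes f :: "'n::finite \<Rightarrow> 'a \<Rightarrow> real"
  assumes "\<And>j. integrable M (f j)"
  shows "integrable M (\<lambda>v. MAX j. f j v)"
proof (rule Bochner_Integration.integrable_bound)
  show "integrable M (\<lambda>v. \<Sum>j\<in>UNIV. \<bar>f j v\<bar>)"
    using assms by auto
  show "(\<lambda>v. MAX j. f j v) \<in> borel_measurable M"
    using assms by (intro borel_measurable_Max) auto
  have "\<bar>MAX j. f j v\<bar> \<le> (\<Sum>j\<in>UNIV. \<bar>f j v\<bar>)" for v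
  proof -
    have "(MAX j. f j v) \<in> range (\<lambda>j. f j v)" by (intro Max_in) auto
    then obtain i where "(MAX j. f j v) = f i v" by blast
    moreover have "\<bar>f i v\<bar> \<le> (\<Sum>j\<in>UNIV. \<bar>f j v\<bar>)"
      by (rule member_le_sum) auto
    ultimately show ?thesis by simp
  qed
  then show "AE v in M. norm (MAX j. f j v) \<le> norm (\<Sum>j\<in>UNIV. \<bar>f j v\<bar>)"
    by (auto intro: order_trans)
qed

text \<open>Unpacks the law of \<open>V\<close> together with integrability of every maximum, on
  which the comparisons and splittings of integrals below rest.\<close>

lemma stdf_representation:
  assumes "is_stdf l"
  obtains M :: "(real ^ 'n::finite) measure"
  where "AE v in M. \<forall>j. 0 \<le> v $ j"
    and "\<And>j. integrable M (\<lambda>v. v $ j)"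
    and "\<And>j. (\<integral>v. v $ j \<partial>M) = 1"
    and "\<And>y. integrable M (\<lambda>v. MAX j. y $ j * v $ j)"
    and "\<And>y. (\<forall>j. 0 \<le> y $ j) \<Longrightarrow> l y = (\<integral>v. (MAX j. y $ j * v $ j) \<partial>M)"
proof -
  obtain M where "AE v in M. \<forall>j. 0 \<le> v $ j"
    and M: "\<And>j. integrable M (\<lambda>v. v $ j)"
    and "\<And>j. (\<integral>v. v $ j \<partial>M) = 1"
    and "\<And>y. (\<forall>j. 0 \<le> y $ j) \<Longrightarrow> l y = (\<integral>v. (MAX j. y $ j * v $ j) \<partial>M)"
    using assms unfolding is_stdf_def by auto
  then show ?thesis
    by (intro that[of M] integrable_Max_range) auto
qed

text \<open>Multiplication by a nonnegative constant is monotone, hence commutes with a finite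
  maximum; the constant then leaves the integral.\<close>

lemma stdf_scale:
  fixes y :: "real ^ 'n::finite"
  assumes "is_stdf l" "\<forall>j. 0 \<le> y $ j" "0 \<le> c"
  shows "l (c *\<^sub>R y) = c * l y"
proof -
  obtain M where M: "\<And>y. (\<forall>j. 0 \<le> y $ j) \<Longrightarrow> l y = (\<integral>v. (MAX j. y $ j * v $ j) \<partial>M)"
    by (rule stdf_representation[OF assms(1)]) (rule that)
  have "(MAX j. (c *\<^sub>R y) $ j * v $ j) = c * (MAX j. y $ j * v $ j)" for v :: "real ^ 'n"
    using mono_Max_commute[of "(*) c" "range (\<lambda>j. y $ j * v $ j)"] assms(3)
    by (simp add: mono_def mult_left_mono image_image mult.assoc)
  then show ?thesis using assms by (simp add: M)
qed

lemma stdf_mono: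
  fixes x y :: "real ^ 'n::finite"
  assumes "is_stdf l" "\<forall>j. 0 \<le> x $ j" "\<forall>j. x $ j \<le> y $ j"
  shows "l x \<le> l y"
proof -
  obtain M where nn: "AE v in M. \<forall>j. 0 \<le> v $ j"
    and I: "\<And>y. integrable M (\<lambda>v. MAX j. y $ j * v $ j)"
    and M: "\<And>y. (\<forall>j. 0 \<le> y $ j) \<Longrightarrow> l y = (\<integral>v. (MAX j. y $ j * v $ j) \<partial>M)"
    by (rule stdf_representation[OF assms(1)]) (rule that)
  have "(\<integral>v. (MAX j. x $ j * v $ j) \<partial>M) \<le> (\<integral>v. (MAX j. y $ j * v $ j) \<partial>M)"
  proof (intro integral_mono_AE I)
    show "AE v in M. (MAX j. x $ j * v $ j) \<le> (MAX j. y $ j * v $ j)"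
      using nn
    proof eventually_elim
      case (elim v)
      have "x $ j * v $ j \<le> (MAX j. y $ j * v $ j)" for j
      proof -
        have "x $ j * v $ j \<le> y $ j * v $ j" using assms(3) elim by (auto intro: mult_right_mono)
        also have "\<dots> \<le> (MAX j. y $ j * v $ j)" by (rule Max_ge) auto
        finally show ?thesis .
      qed
      then show ?case by auto
    qed
  qed
  moreover have "\<forall>j. 0 \<le> y $ j" using assms order_trans by blast
  ultimately show ?thesis using M[of x] M[of y] assms(2) by simp
qed

text \<open>Pointwise in \<open>v\<close>, each entry of the maximum for \<open>x + y\<close> splits
  into two terms, each bounded by its own maximum.\<close>

lemma stdf_subadditive:
  fixes x y :: "real ^ 'n::finite"
  assumes "is_stdf l" "\<forall>j. 0 \<le> x $ j" "\<forall>j. 0 \<le> y $ j"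
  shows "l (x + y) \<le> l x + l y"
proof -
  obtain M where I: "\<And>y. integrable M (\<lambda>v. MAX j. y $ j * v $ j)"
    and M: "\<And>y. (\<forall>j. 0 \<le> y $ j) \<Longrightarrow> l y = (\<integral>v. (MAX j. y $ j * v $ j) \<partial>M)"
    by (rule stdf_representation[OF assms(1)]) (rule that)
  have "(\<integral>v. (MAX j. (x + y) $ j * v $ j) \<partial>M)
      \<le> (\<integral>v. (MAX j. x $ j * v $ j) + (MAX j. y $ j * v $ j) \<partial>M)"
  proof (intro integral_mono I Bochner_Integration.integrable_add)
    fix v :: "real ^ 'n"
    show "(MAX j. (x + y) $ j * v $ j) \<le> (MAX j. x $ j * v $ j) + (MAX j. y $ j * v $ j)"
      by (auto simp: distrib_right intro!: add_mono Max_ge)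
  qed
  then show ?thesis using assms by (simp add: M I)
qed

text \<open>A maximum of nonnegative numbers is at most their sum, and every coordinate of
  \<open>V\<close> has mean one.\<close>

lemma stdf_le_sum:
  fixes x :: "real ^ 'n::finite"
  assumes "is_stdf l" "\<forall>j. 0 \<le> x $ j"
  shows "l x \<le> (\<Sum>j\<in>UNIV. x $ j)"
proof -
  obtain M where nn: "AE v in M. \<forall>j. 0 \<le> v $ j"
    and I1: "\<And>j. integrable M (\<lambda>v. v $ j)" and E: "\<And>j. (\<integral>v. v $ j \<partial>M) = 1"
    and I: "\<And>y. integrable M (\<lambda>v. MAX j. y $ j * v $ j)"
    and M: "\<And>y. (\<forall>j. 0 \<le> y $ j) \<Longrightarrow> l y = (\<integral>v. (MAX j. y $ j * v $ j) \<partial>M)"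
    by (rule stdf_representation[OF assms(1)]) (rule that)
  have "(\<integral>v. (MAX j. x $ j * v $ j) \<partial>M) \<le> (\<integral>v. (\<Sum>j\<in>UNIV. x $ j * v $ j) \<partial>M)"
  proof (intro integral_mono_AE I)
    show "integrable M (\<lambda>v. \<Sum>j\<in>UNIV. x $ j * v $ j)" using I1 by auto
    show "AE v in M. (MAX j. x $ j * v $ j) \<le> (\<Sum>j\<in>UNIV. x $ j * v $ j)"
      using nn
    proof eventually_elim
      case (elim v)
      have "x $ j * v $ j \<le> (\<Sum>j\<in>UNIV. x $ j * v $ j)" for j
        using assms(2) elim by (intro member_le_sum) auto
      then show ?case by auto
    qed
  qed
  also have "\<dots> = (\<Sum>j\<in>UNIV. x $ j)" using I1 E by simp
  finally show ?thesis using M assms(2) by simp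
qed

text \<open>The maximum dominates its \<open>j\<close>-th entry, whose mean is \<open>x $ j\<close>.
  With the bound by the sum, this pins down the limit of \<open>l\<close> when all coordinates but
  one tend to zero.\<close>

lemma stdf_ge_component:
  fixes x :: "real ^ 'n::finite"
  assumes "is_stdf l" "\<forall>j. 0 \<le> x $ j"
  shows "x $ j \<le> l x"
proof -
  obtain M where I1: "\<And>j. integrable M (\<lambda>v. v $ j)" and E: "\<And>j. (\<integral>v. v $ j \<partial>M) = 1"
    and I: "\<And>y. integrable M (\<lambda>v. MAX j. y $ j * v $ j)"
    and M: "\<And>y. (\<forall>j. 0 \<le> y $ j) \<Longrightarrow> l y = (\<integral>v. (MAX j. y $ j * v $ j) \<partial>M)"
    by (rule stdf_representation[OF assms(1)]) (rule that)
  have "(\<integral>v. x $ j * v $ j \<partial>M) \<le> (\<integral>v. (MAX j. x $ j * v $ j) \<partial>M)"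
    by (intro integral_mono I) (use I1 in auto)
  then show ?thesis using M E assms(2) by simp
qed

text \<open>Boundary points of the orthant are approached from its interior: shifting every
  coordinate by \<open>e\<close> raises a stdf by at most the dimension times \<open>e\<close>, so
  agreement at the shifted points passes to \<open>y\<close>.\<close>

lemma stdf_eq_if_eq_on_pos:
  fixes y :: "real ^ 'n::finite"
  assumes l: "is_stdf l" "is_stdf l'"
    and eq: "\<And>z. (\<forall>j. 0 < z $ j) \<Longrightarrow> l z = l' z"
    and y: "\<forall>j. 0 \<le> y $ j"
  shows "l y = l' y"
proof -
  have close: "m y \<le> m (y + (\<chi> j. e)) \<and> m (y + (\<chi> j. e)) \<le> m y + real CARD('n) * e"
    if "is_stdf m" "0 < e" for m and e
    using stdf_mono[OF that(1) y, of "y + (\<chi> j. e)"]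
      stdf_subadditive[OF that(1) y, of "\<chi> j. e"] stdf_le_sum[OF that(1), of "\<chi> j. e"] that(2)
    by auto
  have le: "m y \<le> m' y" if "is_stdf m" "is_stdf m'"
    and mm': "\<And>z. (\<forall>j. 0 < z $ j) \<Longrightarrow> m z = m' z" for m m'
  proof (rule field_le_epsilon)
    fix e :: real assume "0 < e"
    \<comment> \<open>The shift is chosen so that its total cost, summed over the coordinates, is
      exactly \<open>e\<close>.\<close>
    define d where "d = e / real CARD('n)"
    have d: "0 < d" "real CARD('n) * d = e" using \<open>0 < e\<close> by (auto simp: d_def)
    have "\<forall>j. 0 < (y + (\<chi> j. d)) $ j" using y d by (auto intro: add_nonneg_pos)
    then have "m (y + (\<chi> j. d)) = m' (y + (\<chi> j. d))" by (rule mm')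
    then show "m y \<le> m' y + e"
      using close[OF that(1) d(1)] close[OF that(2) d(1)] d(2) by linarith
  qed
  show ?thesis by (rule antisym) (use l eq in \<open>auto intro!: le\<close>)
qed

section \<open>Generalized Pareto survival functions\<close>

text \<open>The univariate generalized Pareto survival function with shape \<open>g\<close> and
  scale \<open>s\<close>, meant for \<open>s > 0\<close> and \<open>t \<ge> 0\<close>. There the
  second case arises only for \<open>g < 0\<close>, at and beyond the upper endpoint
  \<open>- s / g\<close>, where survival is zero.\<close>

definition gp_surv :: "real \<Rightarrow> real \<Rightarrow> real \<Rightarrow> real" where
  "gp_surv g s t = (if s + g * t > 0 then gpow g (t / s) else 0)"

lemma gpow_pos: "1 + g * x > 0 \<Longrightarrow> 0 < gpow g x"
  by (simp add: gpow_def)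

lemma gpow_0 [simp]: "gpow g 0 = 1"
  by (simp add: gpow_def)

lemma gp_surv_0: "s > 0 \<Longrightarrow> gp_surv g s 0 = 1"
  by (simp add: gp_surv_def)

lemma one_plus_mult_divide_pos: "s > 0 \<Longrightarrow> s + g * t > 0 \<Longrightarrow> 1 + g * (t / s) > (0::real)"
  by (simp add: field_simps)

lemma gp_surv_nonneg: "s > 0 \<Longrightarrow> 0 \<le> gp_surv g s t"
  by (auto simp: gp_surv_def intro!: less_imp_le gpow_pos one_plus_mult_divide_pos)

lemma gp_surv_tendsto_0:
  assumes "s > 0"
  shows "((\<lambda>t. gp_surv g s t) \<longlongrightarrow> 0) at_top"
proof (cases g "0 :: real" rule: linorder_cases)
  case less
  have "\<forall>\<^sub>F t in at_top. gp_surv g s t = 0"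
    \<comment> \<open>For negative shape, \<open>s / - g\<close> is the finite upper
      endpoint.\<close>
    using eventually_ge_at_top[of "s / - g"]
    by eventually_elim (use less in \<open>auto simp: gp_surv_def field_simps\<close>)
  then show ?thesis by (rule tendsto_eventually)
next
  case equal
  have "((\<lambda>t. exp (- (t / s))) \<longlongrightarrow> 0) at_top"
    using assms by real_asymp
  then show ?thesis using equal assms by (simp add: gp_surv_def gpow_def)
next
  case greater
  have "((\<lambda>t. (1 + g * (t / s)) powr (- 1 / g)) \<longlongrightarrow> 0) at_top"
    using assms greater by real_asymp
  moreover have "\<forall>\<^sub>F t in at_top. (1 + g * (t / s)) powr (- 1 / g) = gp_surv g s t"
    using eventually_ge_at_top[of 0]
    by eventually_elim (use greater assms in \<open>auto simp: gp_surv_def gpow_def add_pos_nonneg\<close>)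
  ultimately show ?thesis by (rule Lim_transform_eventually)
qed

text \<open>The quantile function is explicit. The level \<open>u = 0\<close> is excluded, since it
  is never attained when \<open>g \<ge> 0\<close>.\<close>

lemma gp_surv_surj:
  assumes "s > 0" "0 < u" "u \<le> 1"
  obtains t where "t \<ge> 0" "gp_surv g s t = u"
proof (cases "g = 0")
  case True
  show ?thesis
    by (rule that[of "- s * ln u"])
      (use assms True in \<open>auto simp: gp_surv_def gpow_def mult_nonneg_nonpos\<close>)
next
  case False
  \<comment> \<open>The solution of \<open>(1 + g * (t / s)) powr (- 1 / g) = u\<close>; it is
    nonnegative because \<open>u powr - g - 1\<close> has the sign of \<open>g\<close> or
    vanishes.\<close>
  define t where "t = s * ((u powr - g - 1) / g)"
  have "0 \<le> (u powr - g - 1) / g"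
  proof (cases "g > 0")
    case True
    then have "1 \<le> u powr - g"
      using assms powr_mono2'[of "- g" u 1] by simp
    then show ?thesis using True by simp
  next
    case g: False
    then have "u powr - g \<le> 1"
      using assms powr_mono2[of "- g" u 1] by simp
    then show ?thesis using g by (auto intro: divide_nonpos_nonpos)
  qed
  then have "t \<ge> 0" using assms unfolding t_def by (intro mult_nonneg_nonneg) auto
  have "1 + g * (t / s) = u powr - g" "s + g * t = s * u powr - g"
    using assms False by (auto simp: t_def field_simps)
  then have "gp_surv g s t = u"
    using assms False by (simp add: gp_surv_def gpow_def powr_powr)
  with \<open>t \<ge> 0\<close> show ?thesis by (rule that)
qed

text \<open>This derivative is the hazard rate; the same expression covers zero and nonzero
  shape.\<close>

lemma gp_surv_log_deriv:
  assumes "s > 0" "s + g * t > 0"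
  shows "((\<lambda>t. - ln (gp_surv g s t)) has_real_derivative 1 / (s + g * t)) (at t)"
proof -
  define S where "S = {t. s + g * t > 0}"
  have "open S" unfolding S_def by (intro open_Collect_less continuous_intros)
  \<comment> \<open>On the open set \<open>S\<close> the logarithm cancels the exponential or the
    power, leaving this closed form; its derivative transfers back to the original function.\<close>
  define f where "f = (\<lambda>t. if g = 0 then t / s else ln (1 + g * (t / s)) / g)"
  have f: "f u = - ln (gp_surv g s u)" if "u \<in> S" for u
    using that one_plus_mult_divide_pos[OF assms(1), of g u]
    by (auto simp: S_def f_def gp_surv_def gpow_def ln_powr)
  have "(f has_real_derivative 1 / (s + g * t)) (at t)"
  proof (cases "g = 0")
    case True
    then show ?thesis using assms by (auto simp: f_def intro!: derivative_eq_intros)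
  next
    case False
    have "1 + g * (t / s) > 0" by (rule one_plus_mult_divide_pos[OF assms])
    then have "((\<lambda>t. ln (1 + g * (t / s)) / g) has_real_derivative
        (1 / (1 + g * (t / s)) * (g * (1 / s))) / g) (at t)"
      using assms False by (auto intro!: derivative_eq_intros)
    moreover have "(1 / (1 + g * (t / s)) * (g * (1 / s))) / g = 1 / (s + g * t)"
      using assms False \<open>1 + g * (t / s) > 0\<close> by (simp add: divide_simps)
    ultimately show ?thesis using False by (simp add: f_def)
  qed
  then show ?thesis
    by (rule has_field_derivative_transform_within_open[OF _ \<open>open S\<close> _ f])
      (use assms(2) in \<open>simp_all add: S_def\<close>)
qed

text \<open>
  The derivative of \<open>- ln (gp_surv g s)\<close> is the reciprocal of the affine function
  \<open>t \<mapsto> s + g t\<close>, whose two coefficients are read off from its values at two points.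
\<close>

lemma gp_surv_inject:
  assumes s: "s > 0" "s' > 0" and eq: "\<And>t. t \<ge> 0 \<Longrightarrow> gp_surv g s t = gp_surv g' s' t"
  shows "g = g' \<and> s = s'"
proof -
  have "\<forall>\<^sub>F t in nhds 0. s + g * t > 0" "\<forall>\<^sub>F t in nhds 0. s' + g' * t > 0"
    using s by (auto intro!: order_tendstoD(1) tendsto_eq_intros filterlim_ident)
  then have "\<forall>\<^sub>F t in nhds (0::real). s + g * t > 0 \<and> s' + g' * t > 0"
    by eventually_elim auto
  then obtain e where e: "e > 0" "\<And>t. \<bar>t\<bar> < e \<Longrightarrow> s + g * t > 0 \<and> s' + g' * t > 0"
    by (auto simp: eventually_nhds_metric dist_real_def)
  \<comment> \<open>The survival functions are known to agree only on the closed half-line, so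
    derivatives are compared at points \<open>t > 0\<close>, which have a neighbourhood inside
    it.\<close>
  have aff: "s + g * t = s' + g' * t" if t: "0 < t" "t < e" for t
  proof -
    have pos: "s + g * t > 0" "s' + g' * t > 0" using e t by auto
    have "((\<lambda>t. - ln (gp_surv g s t)) has_real_derivative 1 / (s' + g' * t)) (at t)"
      by (rule has_field_derivative_transform_within_open[OF gp_surv_log_deriv[OF s(2) pos(2)],
            of "{0<..}"]) (use t eq in auto)
    with gp_surv_log_deriv[OF s(1) pos(1)] have "1 / (s + g * t) = 1 / (s' + g' * t)"
      by (rule DERIV_unique)
    then show ?thesis using pos by simp
  qed
  have "s + g * (e / 2) = s' + g' * (e / 2)" "s + g * (e / 4) = s' + g' * (e / 4)"
    using e(1) aff[of "e / 2"] aff[of "e / 4"] by auto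
  then have "g * e = g' * e" "s = s'" by argo+
  with e(1) show ?thesis by auto
qed

section \<open>Margins of the GEV distribution\<close>

text \<open>Moves the base point from \<open>m\<close> to \<open>0\<close>: the affine term factors
  as \<open>(1 - g * m / a) * (1 + g * t / (a - g * m))\<close>. The first factor yields \<tau>, and
  the second has the new scale \<open>a - g * m\<close>, which is \<sigma>. For \<open>g = 0\<close>
  this is the functional equation of \<open>exp\<close>.\<close>

lemma gpow_split:
  assumes "a > 0" "a - g * m > 0" "a + g * (t - m) > 0"
  shows "gpow g ((t - m) / a) = gpow g (- m / a) * gpow g (t / (a - g * m))"
proof (cases "g = 0")
  case True
  then show ?thesis using assms by (simp add: gpow_def flip: exp_add) (simp add: field_simps)
next
  case False
  have "1 + g * ((t - m) / a) = (1 + g * (- m / a)) * (1 + g * (t / (a - g * m)))"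
    using assms by (simp add: divide_simps) (simp add: algebra_simps)
  moreover have "1 + g * (- m / a) \<ge> 0" "1 + g * (t / (a - g * m)) \<ge> 0"
    using assms one_plus_mult_divide_pos[of "a - g * m" g t] by (auto simp: field_simps)
  ultimately show ?thesis using False by (simp add: gpow_def powr_mult)
qed

lemma gp_tau_eq:
  assumes "gp_sigma \<mu> \<gamma> \<alpha> $ j > 0"
  shows "gp_tau \<mu> \<gamma> \<alpha> $ j = gpow (\<gamma> $ j) (- \<mu> $ j / \<alpha> $ j)"
  using assms by (simp add: gp_tau_def gev_margin_def gp_sigma_def)

lemma gp_tau_pos:
  assumes "\<alpha> $ j > 0" "gp_sigma \<mu> \<gamma> \<alpha> $ j > 0"
  shows "gp_tau \<mu> \<gamma> \<alpha> $ j > 0"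
proof -
  have "1 + \<gamma> $ j * (- \<mu> $ j / \<alpha> $ j) > 0"
    using assms by (simp add: gp_sigma_def field_simps)
  then show ?thesis using assms by (simp add: gp_tau_eq gpow_pos)
qed

lemma gev_margin_nonneg_arg:
  assumes "\<alpha> $ j > 0" "gp_sigma \<mu> \<gamma> \<alpha> $ j > 0" "t \<ge> 0"
  shows "gev_margin \<mu> \<gamma> \<alpha> j t
    = exp (- (gp_tau \<mu> \<gamma> \<alpha> $ j * gp_surv (\<gamma> $ j) (gp_sigma \<mu> \<gamma> \<alpha> $ j) t))"
proof (cases "\<alpha> $ j + \<gamma> $ j * (t - \<mu> $ j) > 0")
  case True
  then have "gp_sigma \<mu> \<gamma> \<alpha> $ j + \<gamma> $ j * t > 0"
    by (simp add: gp_sigma_def algebra_simps)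
  then show ?thesis
    using True assms gpow_split[of "\<alpha> $ j" "\<gamma> $ j" "\<mu> $ j" t]
    by (simp add: gp_tau_eq gev_margin_def gp_surv_def) (simp add: gp_sigma_def)
next
  case False
  then have neg: "\<not> gp_sigma \<mu> \<gamma> \<alpha> $ j + \<gamma> $ j * t > 0"
    by (simp add: gp_sigma_def algebra_simps)
  \<comment> \<open>With \<open>t \<ge> 0\<close> and positive \<sigma>, leaving the support means
    passing the upper endpoint. There the margin is 1, matching \<open>exp 0\<close> on the
    right.\<close>
  then have "\<not> \<gamma> $ j > 0"
    using assms by (meson add_pos_nonneg less_imp_le mult_nonneg_nonneg)
  then show ?thesis using False neg by (simp add: gev_margin_def gp_surv_def)
qed

text \<open>Ensures that the formula for the cdf of \<open>H\<close> applies on the whole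
  nonnegative orthant. The affine term is positive at \<open>0\<close>, hence also at some negative
  \<open>t\<close>.\<close>

lemma lower_endpoint_gev_margin_neg:
  assumes "gp_sigma \<mu> \<gamma> \<alpha> $ j > 0"
  shows "lower_endpoint (gev_margin \<mu> \<gamma> \<alpha> j) < 0"
proof -
  have "((\<lambda>t. \<alpha> $ j + \<gamma> $ j * (t - \<mu> $ j)) \<longlongrightarrow> gp_sigma \<mu> \<gamma> \<alpha> $ j) (at_left 0)"
    by (auto simp: gp_sigma_def intro!: tendsto_eq_intros)
  then have "\<forall>\<^sub>F t in at_left 0. \<alpha> $ j + \<gamma> $ j * (t - \<mu> $ j) > 0"
    using assms by (rule order_tendstoD)
  moreover have "\<forall>\<^sub>F t :: real in at_left 0. t < 0"
    by (auto simp: eventually_at_filter)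
  ultimately have "\<forall>\<^sub>F t in at_left 0. \<alpha> $ j + \<gamma> $ j * (t - \<mu> $ j) > 0 \<and> t < 0"
    by eventually_elim auto
  then obtain t where t: "\<alpha> $ j + \<gamma> $ j * (t - \<mu> $ j) > 0" "t < 0"
    using eventually_happens' trivial_limit_at_left_real by blast
  then have "lower_endpoint (gev_margin \<mu> \<gamma> \<alpha> j) \<le> ereal t"
    unfolding lower_endpoint_def by (intro INF_lower) (simp add: gev_margin_def)
  with t(2) show ?thesis by (metis ereal_less(2) le_less_trans less_ereal.simps(1) zero_ereal_def)
qed

section \<open>The generalized Pareto distribution\<close>

lemma gp_tau_stdf_pos:
  assumes "gp_model \<mu> \<gamma> \<alpha> l H"
  shows "l (gp_tau \<mu> \<gamma> \<alpha>) > 0"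
proof -
  have tau: "gp_tau \<mu> \<gamma> \<alpha> $ j > 0" for j
    using assms by (intro gp_tau_pos) (auto simp: gp_model_def)
  then have "gp_tau \<mu> \<gamma> \<alpha> $ j \<le> l (gp_tau \<mu> \<gamma> \<alpha>)" for j
    using assms tau by (intro stdf_ge_component) (auto simp: gp_model_def less_imp_le)
  then show ?thesis using tau less_le_trans by blast
qed

lemma gp_pi_pos:
  assumes "gp_model \<mu> \<gamma> \<alpha> l H"
  shows "gp_pi \<mu> \<gamma> \<alpha> l $ j > 0"
  using gp_tau_stdf_pos[OF assms] assms gp_tau_pos[of \<alpha> j \<mu> \<gamma>]
  by (simp add: gp_pi_def gp_model_def)

lemma gp_joint_survival:
  assumes "gp_model \<mu> \<gamma> \<alpha> l H" "\<forall>i. 0 \<le> x $ i"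
  shows "1 - joint_cdf H x
    = l (\<chi> j. gp_pi \<mu> \<gamma> \<alpha> l $ j * gp_surv (\<gamma> $ j) (gp_sigma \<mu> \<gamma> \<alpha> $ j) (x $ j))"
proof -
  define S where "S j t = gp_surv (\<gamma> $ j) (gp_sigma \<mu> \<gamma> \<alpha> $ j) t" for j t
  define \<tau> where "\<tau> = gp_tau \<mu> \<gamma> \<alpha>"
  have \<alpha>: "\<And>j. \<alpha> $ j > 0" and \<sigma>: "\<And>j. gp_sigma \<mu> \<gamma> \<alpha> $ j > 0" and l: "is_stdf l"
    and gp: "is_GP (gev_margin \<mu> \<gamma> \<alpha>) (gev_cdf \<mu> \<gamma> \<alpha> l) H"
    using assms(1) by (auto simp: gp_model_def)
  have \<tau>: "\<tau> $ j > 0" for j unfolding \<tau>_def by (rule gp_tau_pos[OF \<alpha> \<sigma>])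
  have l\<tau>: "l \<tau> > 0" using gp_tau_stdf_pos[OF assms(1)] by (simp add: \<tau>_def)
  have S0: "S j 0 = 1" and S: "0 \<le> S j t" for j t
    using \<sigma> by (auto simp: S_def gp_surv_0 gp_surv_nonneg)
  \<comment> \<open>On the nonnegative orthant all margins are exponentials, hence positive, so
    \<open>gev_cdf\<close> is in its first case.\<close>
  have G: "ln (gev_cdf \<mu> \<gamma> \<alpha> l z) = - l (\<chi> j. \<tau> $ j * S j (z $ j))"
    if "\<forall>i. 0 \<le> z $ i" for z
    using that \<alpha> \<sigma> by (simp add: gev_cdf_def gev_margin_nonneg_arg \<tau>_def S_def)
  have "lower_endpoint (gev_margin \<mu> \<gamma> \<alpha> j) < ereal (x $ j)" for j
    using lower_endpoint_gev_margin_neg[OF \<sigma>, of j] assms(2)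
    by (metis ereal_less_eq(5) less_le_trans)
  then have "joint_cdf H x
      = (ln (gev_cdf \<mu> \<gamma> \<alpha> l (\<chi> j. min (x $ j) 0)) - ln (gev_cdf \<mu> \<gamma> \<alpha> l x))
          / ln (gev_cdf \<mu> \<gamma> \<alpha> l 0)"
    using gp by (simp add: is_GP_def)
  moreover have "(\<chi> j. min (x $ j) 0) = 0"
    using assms(2) by (simp add: vec_eq_iff min_absorb2)
  ultimately have "joint_cdf H x = (- l \<tau> + l (\<chi> j. \<tau> $ j * S j (x $ j))) / - l \<tau>"
    using G[OF assms(2)] G[of 0] S0 by simp
  then have "1 - joint_cdf H x = (1 / l \<tau>) * l (\<chi> j. \<tau> $ j * S j (x $ j))"
    using l\<tau> by (simp add: field_simps)
  \<comment> \<open>Homogeneity carries the normalizing factor into the argument, where it turns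
    \<tau> into \<pi>.\<close>
  also have "\<dots> = l ((1 / l \<tau>) *\<^sub>R (\<chi> j. \<tau> $ j * S j (x $ j)))"
    using l l\<tau> \<tau> S by (intro stdf_scale[symmetric]) (auto simp: less_imp_le)
  also have "(1 / l \<tau>) *\<^sub>R (\<chi> j. \<tau> $ j * S j (x $ j))
      = (\<chi> j. gp_pi \<mu> \<gamma> \<alpha> l $ j * S j (x $ j))"
    by (simp add: vec_eq_iff gp_pi_def \<tau>_def)
  finally show ?thesis by (simp add: S_def)
qed

text \<open>Continuity from below: the boxes increase with \<open>n\<close>, and their union is the
  half-space up to the null set where some coordinate is infinite. Coordinates equal to minus
  infinity lie in every box.\<close>

lemma joint_cdf_tendsto_marginal_cdf:
  fixes H :: "(ereal ^ 'n::finite) measure"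
  assumes "prob_space H" and sets: "sets H = sets borel"
    and fin: "AE y in H. \<forall>j. y $ j < \<infinity>"
  shows "(\<lambda>n. joint_cdf H (\<chi> i. if i = j then t else real n)) \<longlonglongrightarrow> marginal_cdf H j t"
proof -
  interpret prob_space H by fact
  have closed: "{y :: ereal ^ 'n. y $ i \<le> a} \<in> sets H" for i a
  proof -
    have "closed {y :: ereal ^ 'n. y $ i \<le> a}"
      by (intro closed_Collect_le continuous_intros)
    then show ?thesis by (simp add: sets)
  qed
  define A where "A n = {y :: ereal ^ 'n. \<forall>i. y $ i \<le> ereal (if i = j then t else real n)}" for n
  have A: "A n \<in> sets H" for n
  proof -
    have "A n = (\<Inter>i. {y. y $ i \<le> ereal (if i = j then t else real n)})"
      unfolding A_def by blast
    then show ?thesis using closed by (auto intro!: sets.countable_INT')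
  qed
  have "incseq A"
  proof (rule monoI, rule subsetI)
    fix m n y assume "m \<le> n" "y \<in> A m"
    have "y $ i \<le> ereal (if i = j then t else real n)" for i
    proof -
      have "y $ i \<le> ereal (if i = j then t else real m)"
        using \<open>y \<in> A m\<close> by (simp add: A_def)
      also have "\<dots> \<le> ereal (if i = j then t else real n)"
        using \<open>m \<le> n\<close> by simp
      finally show ?thesis .
    qed
    then show "y \<in> A n" by (simp add: A_def)
  qed
  then have "(\<lambda>n. measure H (A n)) \<longlonglongrightarrow> measure H (\<Union>n. A n)"
    using A by (intro finite_Lim_measure_incseq) auto
  moreover have "measure H (\<Union>n. A n) = measure H {y. y $ j \<le> ereal t}"
  proof (rule measure_eq_AE)
    show "AE y in H. y \<in> (\<Union>n. A n) \<longleftrightarrow> y \<in> {y. y $ j \<le> ereal t}"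
      using fin
    proof eventually_elim
      case (elim y)
      have "\<exists>n. y \<in> A n" if yj: "y $ j \<le> ereal t"
      proof -
        have "\<forall>i. \<exists>n::nat. y $ i \<le> ereal (real n)"
        proof
          fix i
          have "y $ i \<noteq> \<infinity>" using elim by (metis less_irrefl)
          then obtain n :: nat where "y $ i < ereal (real n)" by (auto simp: less_PInf_Ex_of_nat)
          then have "y $ i \<le> ereal (real n)" by (rule less_imp_le)
          then show "\<exists>n::nat. y $ i \<le> ereal (real n)" by blast
        qed
        \<comment> \<open>Each coordinate has its own integer bound; as there are finitely many, the
          largest one serves for all.\<close>
        then obtain N where N: "\<And>i. y $ i \<le> ereal (real (N i))" by metis
        have "y $ i \<le> ereal (real (Max (range N)))" for i
        proof -
          have "N i \<le> Max (range N)" by (rule Max_ge) auto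
          then have "ereal (real (N i)) \<le> ereal (real (Max (range N)))" by simp
          with N[of i] show ?thesis by (rule order_trans)
        qed
        with yj have "y \<in> A (Max (range N))" by (auto simp: A_def)
        then show ?thesis ..
      qed
      moreover have "y $ j \<le> ereal t" if "y \<in> A n" for n
        using that by (auto simp: A_def dest: spec[of _ j])
      ultimately show ?case by auto
    qed
  qed (use A closed in auto)
  ultimately show ?thesis by (simp add: joint_cdf_def marginal_cdf_def A_def)
qed

text \<open>Fix coordinate \<open>j\<close> at \<open>t\<close> and let the others tend to infinity.
  The argument of \<open>l\<close> then keeps only its \<open>j\<close>-th entry in the limit, and
  \<open>l\<close> is squeezed between that entry and the sum of all entries.\<close>

lemma gp_marginal_survival:
  fixes \<mu> \<gamma> \<alpha> :: "real ^ 'n::finite"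
  assumes "gp_model \<mu> \<gamma> \<alpha> l H" "t \<ge> 0"
  shows "1 - marginal_cdf H j t
    = gp_pi \<mu> \<gamma> \<alpha> l $ j * gp_surv (\<gamma> $ j) (gp_sigma \<mu> \<gamma> \<alpha> $ j) t"
proof -
  \<comment> \<open>Here \<open>S\<close> includes the factor \<open>gp_pi\<close>, so that its
    values are the claimed marginal survival probabilities.\<close>
  define S where "S i t = gp_pi \<mu> \<gamma> \<alpha> l $ i * gp_surv (\<gamma> $ i) (gp_sigma \<mu> \<gamma> \<alpha> $ i) t" for i t
  have \<sigma>: "\<And>j. gp_sigma \<mu> \<gamma> \<alpha> $ j > 0" and l: "is_stdf l"
    and gp: "is_GP (gev_margin \<mu> \<gamma> \<alpha>) (gev_cdf \<mu> \<gamma> \<alpha> l) H"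
    using assms(1) by (auto simp: gp_model_def)
  have S: "0 \<le> S i u" for i u
    using \<sigma> gp_pi_pos[OF assms(1)] by (auto simp: S_def gp_surv_nonneg less_imp_le)
  define x :: "nat \<Rightarrow> real ^ 'n" where "x n = (\<chi> i. if i = j then t else real n)" for n
  define s where "s n = (\<chi> i. S i (x n $ i))" for n
  have s: "\<forall>i. 0 \<le> s n $ i" for n using S by (simp add: s_def)
  have "(\<lambda>n. joint_cdf H (x n)) \<longlonglongrightarrow> marginal_cdf H j t"
    unfolding x_def using gp
    by (intro joint_cdf_tendsto_marginal_cdf) (auto simp: is_GP_def elim: eventually_mono)
  then have "(\<lambda>n. 1 - joint_cdf H (x n)) \<longlonglongrightarrow> 1 - marginal_cdf H j t"
    by (intro tendsto_intros)
  moreover have "1 - joint_cdf H (x n) = l (s n)" for n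
    using gp_joint_survival[OF assms(1), of "x n"] assms(2) by (simp add: x_def s_def S_def)
  ultimately have lim: "(\<lambda>n. l (s n)) \<longlonglongrightarrow> 1 - marginal_cdf H j t" by simp
  have comp: "(\<lambda>n. s n $ i) \<longlonglongrightarrow> (if i = j then S j t else 0)" for i
  proof (cases "i = j")
    case True
    then show ?thesis by (simp add: s_def x_def)
  next
    case False
    have "(\<lambda>n. gp_surv (\<gamma> $ i) (gp_sigma \<mu> \<gamma> \<alpha> $ i) (real n)) \<longlonglongrightarrow> 0"
      using gp_surv_tendsto_0[OF \<sigma>] filterlim_real_sequentially by (rule filterlim_compose)
    then have "(\<lambda>n. S i (real n)) \<longlonglongrightarrow> 0"
      unfolding S_def by (rule tendsto_mult_right_zero)
    then show ?thesis using False by (simp add: s_def x_def)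
  qed
  have "(\<lambda>n. l (s n)) \<longlonglongrightarrow> S j t"
  proof (rule tendsto_sandwich)
    show "\<forall>\<^sub>F n in sequentially. s n $ j \<le> l (s n)"
      using stdf_ge_component[OF l s] by simp
    show "\<forall>\<^sub>F n in sequentially. l (s n) \<le> (\<Sum>i\<in>UNIV. s n $ i)"
      using stdf_le_sum[OF l s] by simp
    show "(\<lambda>n. s n $ j) \<longlonglongrightarrow> S j t" using comp[of j] by simp
    have "(\<lambda>n. \<Sum>i\<in>UNIV. s n $ i) \<longlonglongrightarrow> (\<Sum>i\<in>UNIV. if i = j then S j t else 0)"
      by (intro tendsto_sum comp)
    then show "(\<lambda>n. \<Sum>i\<in>UNIV. s n $ i) \<longlonglongrightarrow> S j t" by simp
  qed
  with lim have "1 - marginal_cdf H j t = S j t" by (rule LIMSEQ_unique)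
  then show ?thesis by (simp add: S_def)
qed

section \<open>Normalization of \<pi> and identifiability\<close>

lemma gp_tau_eq_scaled_pi:
  assumes "gp_model \<mu> \<gamma> \<alpha> l H"
  shows "gp_tau \<mu> \<gamma> \<alpha> = l (gp_tau \<mu> \<gamma> \<alpha>) *\<^sub>R gp_pi \<mu> \<gamma> \<alpha> l"
  using gp_tau_stdf_pos[OF assms] by (simp add: vec_eq_iff gp_pi_def)

text \<open>Apply \<open>l\<close> to the identity expressing \<tau> as \<open>l\<close> of \<tau>
  times \<pi>, use homogeneity, and cancel the positive factor.\<close>

lemma gp_stdf_pi:
  assumes "gp_model \<mu> \<gamma> \<alpha> l H"
  shows "l (gp_pi \<mu> \<gamma> \<alpha> l) = 1"
proof -
  have "l (gp_tau \<mu> \<gamma> \<alpha>) = l (l (gp_tau \<mu> \<gamma> \<alpha>) *\<^sub>R gp_pi \<mu> \<gamma> \<alpha> l)"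
    using gp_tau_eq_scaled_pi[OF assms] by simp
  also have "\<dots> = l (gp_tau \<mu> \<gamma> \<alpha>) * l (gp_pi \<mu> \<gamma> \<alpha> l)"
    using assms gp_pi_pos[OF assms] gp_tau_stdf_pos[OF assms]
    by (intro stdf_scale) (auto simp: gp_model_def less_imp_le)
  finally show ?thesis using gp_tau_stdf_pos[OF assms] by simp
qed

lemma gp_marginal_survival_0:
  assumes "gp_model \<mu> \<gamma> \<alpha> l H"
  shows "1 - marginal_cdf H j 0 = gp_pi \<mu> \<gamma> \<alpha> l $ j"
  using gp_marginal_survival[OF assms, of 0 j] assms by (simp add: gp_model_def gp_surv_0)

lemma gp_joint_survival_eq_stdf:
  assumes "gp_model \<mu> \<gamma> \<alpha> l H" "\<forall>i. 0 \<le> x $ i"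
  shows "1 - joint_cdf H x = l (\<chi> j. 1 - marginal_cdf H j (x $ j))"
  using gp_joint_survival[OF assms] gp_marginal_survival[OF assms(1)] assms(2) by simp

text \<open>The order matters: \<pi> comes first, from the margins at zero; cancelling it leaves the
  survival functions that determine \<gamma> and \<sigma>; the stdf comes last and is compared only
  on the nonnegative orthant, where its values are meaningful.\<close>

lemma gp_identifiable:
  fixes \<mu> \<gamma> \<alpha> :: "real ^ 'n::finite"
  assumes H: "gp_model \<mu> \<gamma> \<alpha> l H" and H': "gp_model \<mu>' \<gamma>' \<alpha>' l' H"
  shows "\<gamma>' = \<gamma>" "gp_sigma \<mu>' \<gamma>' \<alpha>' = gp_sigma \<mu> \<gamma> \<alpha>"
    and "gp_pi \<mu>' \<gamma>' \<alpha>' l' = gp_pi \<mu> \<gamma> \<alpha> l"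
    and "\<forall>j. 0 \<le> y $ j \<Longrightarrow> l' y = l y"
proof -
  have \<sigma>: "\<And>j. gp_sigma \<mu> \<gamma> \<alpha> $ j > 0" "\<And>j. gp_sigma \<mu>' \<gamma>' \<alpha>' $ j > 0"
    and l: "is_stdf l" "is_stdf l'"
    using H H' by (auto simp: gp_model_def)
  note \<pi> = gp_pi_pos[OF H]
  show \<pi>': "gp_pi \<mu>' \<gamma>' \<alpha>' l' = gp_pi \<mu> \<gamma> \<alpha> l"
    using gp_marginal_survival_0[OF H] gp_marginal_survival_0[OF H'] by (simp add: vec_eq_iff)
  have "gp_surv (\<gamma>' $ j) (gp_sigma \<mu>' \<gamma>' \<alpha>' $ j) t = gp_surv (\<gamma> $ j) (gp_sigma \<mu> \<gamma> \<alpha> $ j) t"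
    if "t \<ge> 0" for j t
  proof -
    have "gp_pi \<mu> \<gamma> \<alpha> l $ j * gp_surv (\<gamma>' $ j) (gp_sigma \<mu>' \<gamma>' \<alpha>' $ j) t
        = gp_pi \<mu> \<gamma> \<alpha> l $ j * gp_surv (\<gamma> $ j) (gp_sigma \<mu> \<gamma> \<alpha> $ j) t"
      using gp_marginal_survival[OF H that] gp_marginal_survival[OF H' that] \<pi>' by metis
    then show ?thesis using \<pi>[of j] by simp
  qed
  then have "\<gamma>' $ j = \<gamma> $ j \<and> gp_sigma \<mu>' \<gamma>' \<alpha>' $ j = gp_sigma \<mu> \<gamma> \<alpha> $ j" for j
    by (rule gp_surv_inject[OF \<sigma>(2) \<sigma>(1)])
  then show "\<gamma>' = \<gamma>" "gp_sigma \<mu>' \<gamma>' \<alpha>' = gp_sigma \<mu> \<gamma> \<alpha>"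
    by (auto simp: vec_eq_iff)
  show "l' y = l y" if "\<forall>j. 0 \<le> y $ j"
  proof (rule stdf_eq_if_eq_on_pos[OF l(2,1) _ that])
    fix z :: "real ^ 'n" assume z: "\<forall>j. 0 < z $ j"
    \<comment> \<open>The largest factor for which \<open>c *\<^sub>R z\<close> stays below \<pi> in
      every coordinate, that is, inside the box of attainable marginal survival values.\<close>
    define c where "c = (MIN j. gp_pi \<mu> \<gamma> \<alpha> l $ j / z $ j)"
    have "c \<in> range (\<lambda>j. gp_pi \<mu> \<gamma> \<alpha> l $ j / z $ j)" unfolding c_def by (intro Min_in) auto
    then have c: "c > 0" using z \<pi> by auto
    have "\<exists>t\<ge>0. gp_surv (\<gamma> $ j) (gp_sigma \<mu> \<gamma> \<alpha> $ j) t = c * z $ j / gp_pi \<mu> \<gamma> \<alpha> l $ j" for j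
    proof -
      have "c \<le> gp_pi \<mu> \<gamma> \<alpha> l $ j / z $ j" unfolding c_def by (intro Min_le) auto
      then have "0 < c * z $ j / gp_pi \<mu> \<gamma> \<alpha> l $ j" "c * z $ j / gp_pi \<mu> \<gamma> \<alpha> l $ j \<le> 1"
        using c z \<pi>[of j] by (auto simp: field_simps)
      then show ?thesis using gp_surv_surj[OF \<sigma>(1)] by metis
    qed
    then obtain t where t: "\<And>j. t j \<ge> 0"
      "\<And>j. gp_surv (\<gamma> $ j) (gp_sigma \<mu> \<gamma> \<alpha> $ j) (t j) = c * z $ j / gp_pi \<mu> \<gamma> \<alpha> l $ j"
      by metis
    have nz: "gp_pi \<mu> \<gamma> \<alpha> l $ j \<noteq> 0" for j using \<pi>[of j] by simp
    have "1 - marginal_cdf H j (t j) = c * z $ j" for j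
      using gp_marginal_survival[OF H t(1)] t(2) nz by simp
    then have "(\<chi> j. 1 - marginal_cdf H j ((\<chi> i. t i) $ j)) = c *\<^sub>R z"
      by (simp add: vec_eq_iff)
    \<comment> \<open>Both models express the same joint survival probability of \<open>H\<close> at
      the point \<open>t\<close>, with the same marginal survival values as argument.\<close>
    then have "l' (c *\<^sub>R z) = l (c *\<^sub>R z)"
      using gp_joint_survival_eq_stdf[OF H, of "\<chi> i. t i"]
        gp_joint_survival_eq_stdf[OF H', of "\<chi> i. t i"] t(1) by simp
    then show "l' z = l z"
      using c z l by (simp add: stdf_scale less_imp_le)
  qed
qed

theorem proposition3p2:
  fixes \<mu> \<gamma> \<alpha> :: "real ^ 'n::finite"
    and l :: "real ^ 'n \<Rightarrow> real"
    and H :: "(ereal ^ 'n) measure"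
  assumes "gp_model \<mu> \<gamma> \<alpha> l H"
  shows
    "(\<forall>j. gp_tau \<mu> \<gamma> \<alpha> $ j = gpow (\<gamma> $ j) (- \<mu> $ j / \<alpha> $ j)) \<and>
     l (gp_pi \<mu> \<gamma> \<alpha> l) = 1 \<and>
     (\<forall>j. 1 - marginal_cdf H j 0 = gp_pi \<mu> \<gamma> \<alpha> l $ j) \<and>
     (\<forall>x :: real ^ 'n. (\<forall>i. 0 \<le> x $ i) \<longrightarrow>
        (\<forall>j. gp_sigma \<mu> \<gamma> \<alpha> $ j + \<gamma> $ j * x $ j > 0 \<longrightarrow>
           (1 - marginal_cdf H j (x $ j)) / (1 - marginal_cdf H j 0)
             = gpow (\<gamma> $ j) (x $ j / gp_sigma \<mu> \<gamma> \<alpha> $ j)) \<and>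
        1 - joint_cdf H x = l (\<chi> j. 1 - marginal_cdf H j (x $ j))) \<and>
     l (gp_tau \<mu> \<gamma> \<alpha>) > 0 \<and>
     gp_tau \<mu> \<gamma> \<alpha> = l (gp_tau \<mu> \<gamma> \<alpha>) *\<^sub>R gp_pi \<mu> \<gamma> \<alpha> l \<and>
     (\<forall>\<mu>' \<gamma>' \<alpha>' l'. gp_model \<mu>' \<gamma>' \<alpha>' l' H \<longrightarrow>
        \<gamma>' = \<gamma> \<and>
        gp_sigma \<mu>' \<gamma>' \<alpha>' = gp_sigma \<mu> \<gamma> \<alpha> \<and>
        gp_pi \<mu>' \<gamma>' \<alpha>' l' = gp_pi \<mu> \<gamma> \<alpha> l \<and>
        (\<forall>y. (\<forall>j. 0 \<le> y $ j) \<longrightarrow> l' y = l y) \<and>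
        (\<exists>c>0. gp_tau \<mu>' \<gamma>' \<alpha>' = c *\<^sub>R gp_tau \<mu> \<gamma> \<alpha>))"
proof (intro conjI allI impI)
  have \<sigma>: "\<And>j. gp_sigma \<mu> \<gamma> \<alpha> $ j > 0"
    using assms by (auto simp: gp_model_def)
  show "gp_tau \<mu> \<gamma> \<alpha> $ j = gpow (\<gamma> $ j) (- \<mu> $ j / \<alpha> $ j)" for j
    by (rule gp_tau_eq[OF \<sigma>])
  show "(1 - marginal_cdf H j (x $ j)) / (1 - marginal_cdf H j 0)
      = gpow (\<gamma> $ j) (x $ j / gp_sigma \<mu> \<gamma> \<alpha> $ j)"
    if "\<forall>i. 0 \<le> x $ i" "gp_sigma \<mu> \<gamma> \<alpha> $ j + \<gamma> $ j * x $ j > 0" for x :: "real ^ 'n" and j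
    using gp_marginal_survival[OF assms, of "x $ j" j] gp_marginal_survival_0[OF assms, of j]
      gp_pi_pos[OF assms, of j] that by (simp add: gp_surv_def)
  fix \<mu>' \<gamma>' \<alpha>' l'
  assume *: "gp_model \<mu>' \<gamma>' \<alpha>' l' H"
  note id = gp_identifiable[OF assms *]
  show "\<gamma>' = \<gamma>" "gp_sigma \<mu>' \<gamma>' \<alpha>' = gp_sigma \<mu> \<gamma> \<alpha>" "gp_pi \<mu>' \<gamma>' \<alpha>' l' = gp_pi \<mu> \<gamma> \<alpha> l"
    by (rule id)+
  show "l' y = l y" if "\<forall>j. 0 \<le> y $ j" for y
    by (rule id(4)[OF that])
  \<comment> \<open>Both vectors are multiples of the common \<pi>, so the constant is the ratio of
    their normalizing factors.\<close>
  define c where "c = l' (gp_tau \<mu>' \<gamma>' \<alpha>') / l (gp_tau \<mu> \<gamma> \<alpha>)"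
  have "c > 0" using gp_tau_stdf_pos[OF *] gp_tau_stdf_pos[OF assms] by (simp add: c_def)
  moreover have "gp_tau \<mu>' \<gamma>' \<alpha>' = c *\<^sub>R gp_tau \<mu> \<gamma> \<alpha>"
  proof -
    have "gp_tau \<mu>' \<gamma>' \<alpha>' = l' (gp_tau \<mu>' \<gamma>' \<alpha>') *\<^sub>R gp_pi \<mu> \<gamma> \<alpha> l"
      using gp_tau_eq_scaled_pi[OF *] id(3) by simp
    then show ?thesis by (simp add: c_def gp_pi_def vec_eq_iff)
  qed
  ultimately show "\<exists>c>0. gp_tau \<mu>' \<gamma>' \<alpha>' = c *\<^sub>R gp_tau \<mu> \<gamma> \<alpha>" by blast
qed (rule gp_stdf_pi[OF assms] gp_marginal_survival_0[OF assms]
    gp_joint_survival_eq_stdf[OF assms] gp_tau_stdf_pos[OF assms]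
    gp_tau_eq_scaled_pi[OF assms]; assumption)+

end
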